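(* Let $P(z)=\sum_{k=0}^{m}A_kz^k$, with $A_k\in\mathbb{M}_{n,n}$, be a matrix polynomial of degree $m\ge 1$ with $A_0$ and $A_m$ non-singular. Then all eigenvalues of $P(z)$ lie in the ring-shaped region $D=\{z\in\mathbb{C}: r_1\le|z|\le r_2\}$, where $$r_1=\min_{1\le k\le m}\left\{2^{3(1-m)}\binom{2m}{m+k}\mathcal{P}_k^2\,\frac{1}{\|A_0^{-1}\|\,\|A_k\|}\right\}^{1/k}$$ and $$r_2=\max_{1\le k\le m}\left\{2^{3(m-1)}\binom{2m}{m+k}^{-1}\mathcal{P}_k^{-2}\,\|A_{m-k}\|\,\|A_m^{-1}\|\right\}^{1/k}.$$
   Context: $\mathbb{M}_{n,n}$ denotes the set of $n\times n$ complex matrices. A matrix polynomial of degree $m$ is a function $P(z)=\sum_{k=0}^m A_kz^k$ with $A_k\in\mathbb{M}_{n,n}$ and $A_m\ne0$. An eigenvalue of $P(z)$ is a number $\lambda\in\mathbb{C}$ for which there is a non-zero vector $u\in\mathbb{C}^n$ with $P(\lambda)u=0$. $\|\cdot\|$ denotes a subordinate matrix norm, i.e. the operator norm on $\mathbb{M}_{n,n}$ induced by a vector norm on $\mathbb{C}^n$. $\mathcal{P}_k$ denotes the $k$-th Pell number: $\mathcal{P}_0=0$, $\mathcal{P}_1=1$, and $\mathcal{P}_k=2\mathcal{P}_{k-1}+\mathcal{P}_{k-2}$ for $k\ge2$. In the definition of $r_1$, indices $k$ with $A_k=0$ are read as contributing $+\infty$ (i.e. they are omitted from the minimum). *)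

theory Defs
  imports "HOL-Analysis.Analysis"
begin

definition vector_norm :: "(complex ^ 'n \<Rightarrow> real) \<Rightarrow> bool" where
  "vector_norm N \<longleftrightarrow>
     (\<forall>x. 0 \<le> N x) \<and>
     (\<forall>x. N x = 0 \<longleftrightarrow> x = 0) \<and>
     (\<forall>c x. N (c *s x) = cmod c * N x) \<and>
     (\<forall>x y. N (x + y) \<le> N x + N y)"

text \<open>
  The library constant \<^const>\<open>onorm\<close> is tied to the Euclidean norm of \<^typ>\<open>complex ^ 'n\<close>,
  so the operator norm induced by an arbitrary vector norm is defined here. When
  \<^term>\<open>vector_norm N\<close> holds, the set is non-empty and, the dimension being finite, bounded above;
  the real supremum is therefore the true one.
\<close>

definition subordinate_norm :: "(complex ^ 'n \<Rightarrow> real) \<Rightarrow> complex ^ 'n ^ 'n \<Rightarrow> real" where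
  "subordinate_norm N A = (SUP x\<in>{x. x \<noteq> 0}. N (A *v x) / N x)"

text \<open>
  A matrix polynomial is given by its coefficients \<open>A 0, \<dots>, A m\<close>; the values \<open>A k\<close> with
  \<open>k > m\<close> are never used. The scalar multiple of a matrix is written entrywise, since
  the library only provides it for real scalars.
\<close>

definition matrix_poly :: "nat \<Rightarrow> (nat \<Rightarrow> complex ^ 'n ^ 'n) \<Rightarrow> complex \<Rightarrow> complex ^ 'n ^ 'n" where
  "matrix_poly m A z = (\<Sum>k\<le>m. \<chi> i j. z ^ k * A k $ i $ j)"

definition eigenvalues :: "(complex \<Rightarrow> complex ^ 'n ^ 'n) \<Rightarrow> complex set" where
  "eigenvalues P = {l. \<exists>u. u \<noteq> 0 \<and> P l *v u = 0}"

fun pell :: "nat \<Rightarrow> nat" where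
  "pell 0 = 0"
| "pell (Suc 0) = 1"
| "pell (Suc (Suc k)) = 2 * pell (Suc k) + pell k"

text \<open>
  Indices with \<open>A k = 0\<close>, whose term would be infinite, are omitted from the minimum. The index set
  is non-empty whenever \<open>m \<ge> 1\<close> and \<open>A m \<noteq> 0\<close>. The exponent of 2 is an integer, as it is
  non-positive.
\<close>

definition inner_radius :: "(complex ^ 'n \<Rightarrow> real) \<Rightarrow> nat \<Rightarrow> (nat \<Rightarrow> complex ^ 'n ^ 'n) \<Rightarrow> real" where
  "inner_radius N m A =
     (MIN k\<in>{k\<in>{1..m}. A k \<noteq> 0}.
        root k (2 powi (3 * (1 - int m)) * real ((2 * m) choose (m + k)) * real (pell k) ^ 2
          * (1 / (subordinate_norm N (matrix_inv (A 0)) * subordinate_norm N (A k)))))"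

definition outer_radius :: "(complex ^ 'n \<Rightarrow> real) \<Rightarrow> nat \<Rightarrow> (nat \<Rightarrow> complex ^ 'n ^ 'n) \<Rightarrow> real" where
  "outer_radius N m A =
     (MAX k\<in>{1..m}.
        root k (2 powi (3 * (int m - 1)) * inverse (real ((2 * m) choose (m + k)))
          * inverse (real (pell k) ^ 2)
          * subordinate_norm N (A (m - k)) * subordinate_norm N (matrix_inv (A m))))"

end

theory Submission
  imports Defs
begin

text \<open>
  The numbers \<open>w\<^sub>k = binom(2m, m+k) P\<^sub>k\<^sup>2 / 2\<^bsup>3(m-1)\<^esup>\<close>, \<open>1 \<le> k \<le> m\<close>, are positive and sum to 1.
  If \<open>\<bar>z\<bar>\<close> were smaller than \<open>r\<^sub>1\<close>, then \<open>\<parallel>A\<^sub>0\<^sup>-\<^sup>1\<parallel> \<parallel>z\<^sup>k A\<^sub>k\<parallel> < w\<^sub>k\<close> for every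
  \<open>k \<ge> 1\<close>, so \<open>A\<^sub>0 u\<close> would strictly dominate the rest of \<open>P(z) u\<close>; if \<open>\<bar>z\<bar>\<close> were larger
  than \<open>r\<^sub>2\<close>, the leading term would dominate in the same way.

  With \<open>a = 1 + \<surd>2\<close> and \<open>b = \<surd>2 - 1 = 1/a\<close>, Binet's formula gives
  \<open>8 P\<^sub>k\<^sup>2 = a\<^bsup>2k\<^esup> + b\<^bsup>2k\<^esup> - 2(-1)\<^sup>k\<close>, so the sum of the weights comes from the binomial
  expansions of \<open>(a + b)\<^bsup>2m\<^esup> = 8\<^sup>m\<close> and \<open>(1 - 1)\<^bsup>2m\<^esup> = 0\<close>, using the symmetry \<open>k \<mapsto> -k\<close>.
\<close>

section \<open>Pell numbers\<close>

lemma pell_pos: "k \<ge> 1 \<Longrightarrow> pell k > 0"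
  by (induction k rule: pell.induct) auto

text \<open>Both \<open>1 + sqrt 2\<close> and \<open>1 - sqrt 2\<close> are roots of x^2 = 2x + 1,
  so their powers satisfy the Pell recurrence.\<close>

lemma pell_binet:
  "2 * sqrt 2 * real (pell k) = (1 + sqrt 2) ^ k - (1 - sqrt 2) ^ k"
proof (induction k rule: pell.induct)
  case (3 k)
  have r: "x ^ Suc (Suc k) = 2 * x ^ Suc k + x ^ k" if "x\<^sup>2 = 2 * x + 1" for x :: real
  proof -
    have "x ^ Suc (Suc k) = x\<^sup>2 * x ^ k" by (simp add: power2_eq_square)
    also have "\<dots> = (2 * x + 1) * x ^ k" by (simp only: that)
    finally show ?thesis by (simp add: algebra_simps)
  qed
  have "(1 + sqrt 2)\<^sup>2 = 2 * (1 + sqrt 2) + 1" "(1 - sqrt 2)\<^sup>2 = 2 * (1 - sqrt 2) + 1"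
    by (auto simp: power2_eq_square algebra_simps)
  from this[THEN r] show ?case
    using 3 by (simp only: pell.simps of_nat_add of_nat_mult of_nat_numeral)
      (simp add: ring_distribs del: power_Suc)
qed auto

text \<open>Squaring Binet's formula leaves a cross term governed by the product of the conjugates,
  which is -1. The even exponent allows \<open>1 - sqrt 2\<close> to be replaced by the positive
  \<open>sqrt 2 - 1\<close>, the inverse of \<open>sqrt 2 + 1\<close>.\<close>

lemma pell_square:
  "8 * real (pell k) ^ 2 = (sqrt 2 + 1) ^ (2 * k) + (sqrt 2 - 1) ^ (2 * k) - 2 * (- 1) ^ k"
proof -
  have "8 * real (pell k) ^ 2 = (2 * sqrt 2 * real (pell k))\<^sup>2"
    by (simp add: power_mult_distrib)
  also have "\<dots> = ((1 + sqrt 2) ^ k)\<^sup>2 + ((1 - sqrt 2) ^ k)\<^sup>2 - 2 * ((1 + sqrt 2) * (1 - sqrt 2)) ^ k"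
    unfolding pell_binet by (simp add: power2_diff power_mult_distrib)
  also have "(1 + sqrt 2) * (1 - sqrt 2) = - 1"
    by (simp add: algebra_simps)
  also have "((1 - sqrt 2) ^ k)\<^sup>2 = (sqrt 2 - 1) ^ (2 * k)"
    by (metis power2_commute power_commutes power_mult mult.commute)
  also have "((1 + sqrt 2) ^ k)\<^sup>2 = (sqrt 2 + 1) ^ (2 * k)"
    by (metis power_mult mult.commute add.commute)
  finally show ?thesis .
qed

text \<open>The induction peels off the two outermost terms, equal by symmetry, and applies the
  hypothesis to the shifted function, whose centre is again in the middle.\<close>

lemma sum_symmetric_nat:
  fixes f :: "nat \<Rightarrow> 'a :: comm_semiring_1"
  assumes "\<And>k. k \<in> {1..m} \<Longrightarrow> f (m - k) = f (m + k)"
  shows "(\<Sum>j\<le>2 * m. f j) = f m + 2 * (\<Sum>k = 1..m. f (m + k))"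
  using assms
proof (induction m arbitrary: f)
  case (Suc m)
  have "f (Suc (m - k)) = f (Suc (m + k))" if "k \<in> {1..m}" for k
    using Suc.prems[of k] that by (simp add: Suc_diff_le)
  then have IH: "(\<Sum>j\<le>2 * m. f (Suc j)) = f (Suc m) + 2 * (\<Sum>k = 1..m. f (Suc m + k))"
    using Suc.IH[of "\<lambda>j. f (Suc j)"] by simp
  have "(\<Sum>j\<le>2 * Suc m. f j) = f 0 + (\<Sum>j\<le>2 * m. f (Suc j)) + f (2 * Suc m)"
    using sum.atMost_Suc_shift[of f "2 * m"] by simp
  moreover have "f 0 = f (2 * Suc m)"
    using Suc.prems[of "Suc m"] by (simp add: mult_2)
  moreover have "(\<Sum>k = 1..Suc m. f (Suc m + k)) = (\<Sum>k = 1..m. f (Suc m + k)) + f (2 * Suc m)"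
    by (simp add: mult_2)
  ultimately show ?case by (simp only: IH) (simp only: distrib_left mult_2 add_ac)
qed simp

lemma sum_binomial_pell_square:
  assumes "m \<ge> 1"
  shows "(\<Sum>k = 1..m. real ((2 * m) choose (m + k)) * real (pell k) ^ 2) = 8 ^ (m - 1)"
proof -
  define a b :: real where "a = sqrt 2 + 1" and "b = sqrt 2 - 1"
  have ab: "a * b = 1" "a + b = 2 * sqrt 2"
    by (auto simp: a_def b_def algebra_simps)
  have pow: "a ^ (i + l) * b ^ i = a ^ l" "b ^ (i + l) * a ^ i = b ^ l" for i l
    using ab(1) by (simp_all add: power_add mult_ac flip: power_mult_distrib)
  \<comment> \<open>Both orders of \<open>a\<close> and \<open>b\<close> occur, so that
    \<open>f\<close> is symmetric about \<open>m\<close>; the factor \<open>(- 1) ^ m\<close> turns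
    the sign at \<open>m + k\<close> into \<open>(- 1) ^ k\<close>, as in
    \<open>pell_square\<close>.\<close>
  define f where "f j = real ((2 * m) choose j) *
      (a ^ j * b ^ (2 * m - j) + b ^ j * a ^ (2 * m - j) - 2 * (- 1) ^ m * (- 1) ^ j)" for j
  have right: "f (m + k) = 8 * (real ((2 * m) choose (m + k)) * real (pell k) ^ 2)"
    if "k \<le> m" for k
  proof -
    \<comment> \<open>This splitting lets \<open>m - k\<close> factors \<open>a * b = 1\<close>
      cancel.\<close>
    have "m + k = (m - k) + 2 * k" "2 * m - (m + k) = m - k" using that by auto
    then have "a ^ (m + k) * b ^ (2 * m - (m + k)) = a ^ (2 * k)"
      "b ^ (m + k) * a ^ (2 * m - (m + k)) = b ^ (2 * k)"
      using pow[of "m - k" "2 * k"] by metis+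
    moreover have "(- 1) ^ m * (- 1) ^ (m + k) = (- 1 :: real) ^ k"
      by (simp add: power_add flip: mult.assoc power_mult_distrib)
    ultimately show ?thesis
      unfolding f_def using pell_square[of k] by (simp add: a_def b_def mult.assoc)
  qed
  have left: "f (m - k) = f (m + k)" if "k \<in> {1..m}" for k
  proof -
    have "2 * m - (m - k) = m + k" "2 * m - (m + k) = m - k" using that by auto
    moreover have "(2 * m) choose (m - k) = (2 * m) choose (m + k)"
      using that binomial_symmetric[of "m - k" "2 * m"] by (simp add: calculation)
    moreover have "(- 1 :: real) ^ (m - k) = (- 1) ^ (m + k)"
      using that by (simp add: minus_one_power_iff)
    ultimately show ?thesis unfolding f_def by (simp add: algebra_simps)
  qed
  have "(\<Sum>j\<le>2 * m. f j) = (\<Sum>j\<le>2 * m. real ((2 * m) choose j) * a ^ j * b ^ (2 * m - j))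
      + (\<Sum>j\<le>2 * m. real ((2 * m) choose j) * b ^ j * a ^ (2 * m - j))
      - 2 * (- 1) ^ m * (\<Sum>j\<le>2 * m. real ((2 * m) choose j) * (- 1) ^ j * 1 ^ (2 * m - j))"
    unfolding f_def sum_distrib_left sum.distrib[symmetric] sum_subtractf[symmetric]
    by (intro sum.cong) (auto simp: algebra_simps)
  \<comment> \<open>The last power vanishes because \<open>m\<close> is positive.\<close>
  also have "\<dots> = (a + b) ^ (2 * m) + (b + a) ^ (2 * m) - 2 * (- 1) ^ m * (- 1 + 1) ^ (2 * m)"
    unfolding binomial_ring ..
  also have "\<dots> = 2 * 8 ^ m"
    using assms by (simp add: ab(2) add.commute[of b a] power_mult power_mult_distrib power_0_left)
  finally have "(\<Sum>j\<le>2 * m. f j) = 2 * 8 ^ m" .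
  moreover have "(\<Sum>j\<le>2 * m. f j) = f m + 2 * (\<Sum>k = 1..m. f (m + k))"
    using left by (rule sum_symmetric_nat)
  moreover have "f m = 0" using right[of 0] by simp
  moreover have "(\<Sum>k = 1..m. f (m + k))
      = 8 * (\<Sum>k = 1..m. real ((2 * m) choose (m + k)) * real (pell k) ^ 2)"
    unfolding sum_distrib_left by (intro sum.cong) (simp_all only: right atLeastAtMost_iff)
  moreover have "(8 :: real) ^ m = 8 * 8 ^ (m - 1)"
    using assms by (simp add: power_eq_if)
  ultimately show ?thesis by simp
qed

section \<open>Subordinate norms\<close>

lemma matrix_inv_inverse:
  fixes B :: "'a :: semiring_1 ^ 'n ^ 'm"
  assumes "invertible B"
  shows "B ** matrix_inv B = mat 1" and "matrix_inv B ** B = mat 1"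
  using someI_ex[OF assms[unfolded invertible_def]] by (simp_all add: matrix_inv_def)

context
  fixes N :: "complex ^ 'n \<Rightarrow> real"
  assumes N: "vector_norm N"
begin

section \<open>Basic properties of vector norms and equivalence with the Euclidean norm\<close>

lemma vector_norm_nonneg: "0 \<le> N x"
  and vector_norm_eq_0: "N x = 0 \<longleftrightarrow> x = 0"
  and vector_norm_scale: "N (c *s x) = cmod c * N x"
  and vector_norm_triangle: "N (x + y) \<le> N x + N y"
  using N by (auto simp: vector_norm_def)

lemma vector_norm_zero: "N 0 = 0"
  by (simp add: vector_norm_eq_0)

lemma vector_norm_pos: "x \<noteq> 0 \<Longrightarrow> 0 < N x"
  using vector_norm_nonneg[of x] vector_norm_eq_0[of x] by linarith

lemma vector_norm_minus: "N (- x) = N x"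
  using vector_norm_scale[of "-1" x] by simp

lemma vector_norm_sum: "N (sum f S) \<le> (\<Sum>i\<in>S. N (f i))"
proof (induction S rule: infinite_finite_induct)
  case (insert i S)
  then show ?case using vector_norm_triangle[of "f i" "sum f S"] by simp
qed (simp_all add: vector_norm_zero)

lemma vector_norm_le_norm:
  obtains C where "C > 0" "\<And>x. N x \<le> C * norm x"
proof
  define C where "C = (\<Sum>i\<in>UNIV. N (axis i 1))"
  show "C + 1 > 0"
    using sum_nonneg[of UNIV "\<lambda>i. N (axis i 1)"] by (simp add: C_def vector_norm_nonneg)
  fix x
  have "N x = N (\<Sum>i\<in>UNIV. (x $ i) *s axis i 1)" by (simp add: basis_expansion)
  also have "\<dots> \<le> (\<Sum>i\<in>UNIV. cmod (x $ i) * N (axis i 1))"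
    using vector_norm_sum[of "\<lambda>i. (x $ i) *s axis i 1" UNIV] by (simp add: vector_norm_scale)
  also have "\<dots> \<le> (\<Sum>i\<in>UNIV. norm x * N (axis i 1))"
    by (intro sum_mono mult_right_mono) (auto simp: vector_norm_nonneg Finite_Cartesian_Product.norm_nth_le)
  also have "\<dots> = C * norm x" by (simp add: C_def sum_distrib_left mult.commute)
  also have "\<dots> \<le> (C + 1) * norm x" by (simp add: algebra_simps)
  finally show "N x \<le> (C + 1) * norm x" .
qed

text \<open>\<open>N\<close> is Lipschitz for the Euclidean norm, so it attains a minimum on the
  compact unit sphere. The minimum is positive, and homogeneity carries the bound to all
  vectors.\<close>

lemma norm_le_vector_norm:
  obtains c where "c > 0" "\<And>x. c * norm x \<le> N x"
proof -
  obtain C where C: "C > 0" "\<And>x. N x \<le> C * norm x" using vector_norm_le_norm by blast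
  have lip: "\<bar>N x - N y\<bar> \<le> C * norm (x - y)" for x y
  proof -
    have "N x \<le> N (x - y) + N y" using vector_norm_triangle[of "x - y" y] by simp
    moreover have "N y \<le> N (x - y) + N x"
      using vector_norm_triangle[of "- (x - y)" x] vector_norm_minus[of "x - y"] by simp
    ultimately show ?thesis using C(2)[of "x - y"] by linarith
  qed
  have "C-lipschitz_on (sphere 0 1) N"
    using C(1) lip by (intro lipschitz_onI) (auto simp: dist_norm)
  then have cont: "continuous_on (sphere 0 1) N"
    by (rule lipschitz_on_continuous_on)
  \<comment> \<open>Any index gives a unit vector; the infimum is attained only on a nonempty
    sphere.\<close>
  have "norm (axis undefined 1 :: complex ^ 'n) = 1" by (simp add: norm_axis_1)
  then have "sphere 0 1 \<noteq> ({} :: (complex ^ 'n) set)" by (auto simp del: norm_axis_1)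
  from continuous_attains_inf[OF compact_sphere this cont] obtain y where
    y: "norm y = 1" "\<And>x. norm x = 1 \<Longrightarrow> N y \<le> N x" by auto
  have "y \<noteq> 0" using y(1) by auto
  show thesis
  proof (rule that)
    show "N y > 0" using vector_norm_pos \<open>y \<noteq> 0\<close> .
    show "N y * norm x \<le> N x" for x
    proof (cases "x = 0")
      case True
      then show ?thesis by (simp add: vector_norm_nonneg)
    next
      case False
      have "x = complex_of_real (norm x) *s sgn x"
        using False by (simp add: vec_eq_iff sgn_div_norm scaleR_conv_of_real[where 'a=complex])
      then have "N x = norm x * N (sgn x)"
        using vector_norm_scale[of "complex_of_real (norm x)" "sgn x"] by simp
      then show ?thesis
        using False y(2)[of "sgn x"] by (simp add: norm_sgn mult.commute[of "N y"] mult_left_mono)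
    qed
  qed
qed

text \<open>Boundedness in the Euclidean norm transfers through the two norm comparisons. It makes
  the real supremum in \<open>subordinate_norm\<close> a genuine upper bound.\<close>

lemma bdd_above_subordinate_norm: "bdd_above ((\<lambda>x. N (A *v x) / N x) ` {x. x \<noteq> 0})"
proof -
  obtain C where C: "C > 0" "\<And>x. N x \<le> C * norm x" using vector_norm_le_norm by blast
  obtain c where c: "c > 0" "\<And>x. c * norm x \<le> N x" using norm_le_vector_norm by blast
  have "bounded_linear ((*v) A)" by (rule matrix_vector_mul_bounded_linear)
  then obtain K where K: "K \<ge> 0" "\<And>x. norm (A *v x) \<le> norm x * K"
    using bounded_linear.nonneg_bounded by blast
  show ?thesis
  proof (rule bdd_aboveI2)
    fix x :: "complex ^ 'n" assume "x \<in> {x. x \<noteq> 0}"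
    then have "N x > 0" using vector_norm_pos by simp
    have "N (A *v x) \<le> C * (norm x * K)"
      using C K(2)[of x] by (meson order.trans mult_left_mono less_imp_le)
    also have "\<dots> = (C * K / c) * (c * norm x)" using c(1) by simp
    also have "\<dots> \<le> (C * K / c) * N x"
      using C(1) c K(1) by (intro mult_left_mono) auto
    finally show "N (A *v x) / N x \<le> C * K / c"
      using \<open>N x > 0\<close> by (simp add: pos_divide_le_eq)
  qed
qed

lemma subordinate_norm_upper: "x \<noteq> 0 \<Longrightarrow> N (A *v x) / N x \<le> subordinate_norm N A"
  unfolding subordinate_norm_def by (intro cSUP_upper bdd_above_subordinate_norm) simp

lemma subordinate_norm_bound: "N (A *v x) \<le> subordinate_norm N A * N x"
  using subordinate_norm_upper[of x A] vector_norm_pos[of x]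
  by (cases "x = 0") (auto simp: vector_norm_zero pos_divide_le_eq)

lemma subordinate_norm_nonneg: "0 \<le> subordinate_norm N A"
proof -
  have "axis undefined 1 \<noteq> (0 :: complex ^ 'n)" by (simp add: axis_eq_0_iff)
  then show ?thesis
    using subordinate_norm_upper[of "axis undefined 1" A]
    by (meson divide_nonneg_nonneg order.trans vector_norm_nonneg)
qed

lemma subordinate_norm_pos:
  assumes "A \<noteq> 0"
  shows "0 < subordinate_norm N A"
proof -
  obtain x where "A *v x \<noteq> 0" using assms matrix_eq[of A 0] by auto
  then have "0 < N (A *v x)" by (rule vector_norm_pos)
  then have "0 < subordinate_norm N A * N x" using subordinate_norm_bound by (rule less_le_trans)
  then show ?thesis
    using vector_norm_nonneg[of x] by (simp add: zero_less_mult_iff)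
qed

lemma subordinate_norm_zero: "subordinate_norm N 0 = 0"
proof -
  have "{x :: complex ^ 'n. x \<noteq> 0} \<noteq> {}" using axis_eq_0_iff[of _ "1 :: complex"] by fastforce
  then show ?thesis by (simp add: subordinate_norm_def vector_norm_zero)
qed

text \<open>Solving the relation for \<open>u\<close> with the inverse of \<open>B\<close>, taking
  norms and cancelling \<open>N u > 0\<close> gives the bound. It serves both radii, with
  \<open>B\<close> the constant or the leading coefficient.\<close>

lemma subordinate_norm_sum_ge_1:
  assumes "invertible B" and "u \<noteq> 0" and "finite I" and "B *v u + (\<Sum>k\<in>I. c k *s (D k *v u)) = 0"
  shows "1 \<le> (\<Sum>k\<in>I. subordinate_norm N (matrix_inv B) * (cmod (c k) * subordinate_norm N (D k)))"
proof -
  let ?b = "subordinate_norm N (matrix_inv B)"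
  have "u = matrix_inv B *v (B *v u)"
    using assms(1) by (simp add: matrix_vector_mul_assoc matrix_inv_inverse)
  also have "B *v u = - (\<Sum>k\<in>I. c k *s (D k *v u))"
    using assms(4) by (simp add: eq_neg_iff_add_eq_0)
  finally have "N u \<le> ?b * N (- (\<Sum>k\<in>I. c k *s (D k *v u)))"
    using subordinate_norm_bound by metis
  also have "\<dots> \<le> ?b * (\<Sum>k\<in>I. N (c k *s (D k *v u)))"
    unfolding vector_norm_minus
    by (intro mult_left_mono vector_norm_sum subordinate_norm_nonneg)
  also have "\<dots> \<le> ?b * (\<Sum>k\<in>I. cmod (c k) * (subordinate_norm N (D k) * N u))"
    unfolding vector_norm_scale
    by (intro mult_left_mono sum_mono subordinate_norm_bound subordinate_norm_nonneg) auto
  also have "\<dots> = (\<Sum>k\<in>I. ?b * (cmod (c k) * subordinate_norm N (D k))) * N u"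
    by (simp add: sum_distrib_left sum_distrib_right mult_ac)
  finally show ?thesis using vector_norm_pos[OF assms(2)] by simp
qed

end

section \<open>Location of the eigenvalues\<close>

lemma matrix_poly_mult_vec:
  "matrix_poly m A z *v u = (\<Sum>k\<le>m. z ^ k *s (A k *v u))"
proof -
  have "(\<Sum>j\<in>UNIV. (\<Sum>k\<le>m. z ^ k * A k $ i $ j) * u $ j)
      = (\<Sum>k\<le>m. z ^ k * (\<Sum>j\<in>UNIV. A k $ i $ j * u $ j))" for i
    unfolding sum_distrib_left sum_distrib_right
    by (subst sum.swap) (simp add: mult_ac)
  then show ?thesis
    by (simp add: vec_eq_iff matrix_poly_def matrix_vector_mult_def)
qed

lemma matrix_inv_nonzero:
  fixes B :: "'a :: field ^ 'n ^ 'n"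
  assumes "invertible B"
  shows "matrix_inv B \<noteq> 0"
proof
  assume "matrix_inv B = 0"
  then have "(mat 1 :: 'a ^ 'n ^ 'n) = 0" using matrix_inv_inverse(1)[OF assms] by simp
  then have "mat 1 *v axis undefined 1 = (0 :: 'a ^ 'n ^ 'n) *v axis undefined 1" by simp
  then show False by (simp add: axis_eq_0_iff)
qed

section \<open>Normalised weights and the radii expressed through them\<close>

definition pell_weight :: "nat \<Rightarrow> nat \<Rightarrow> real" where
  "pell_weight m k = real ((2 * m) choose (m + k)) * real (pell k) ^ 2 / 8 ^ (m - 1)"

lemma sum_pell_weight: "m \<ge> 1 \<Longrightarrow> (\<Sum>k = 1..m. pell_weight m k) = 1"
  unfolding pell_weight_def sum_divide_distrib[symmetric]
  by (simp only: sum_binomial_pell_square) simp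

lemma pell_weight_pos: "k \<in> {1..m} \<Longrightarrow> 0 < pell_weight m k"
  by (simp add: pell_weight_def pell_pos)

lemma powi_eq_power_8:
  assumes "m \<ge> 1"
  shows "2 powi (3 * (int m - 1)) = (8 :: real) ^ (m - 1)"
    and "2 powi (3 * (1 - int m)) = 1 / (8 :: real) ^ (m - 1)"
proof -
  have *: "3 * (int m - 1) = int (3 * (m - 1))" using assms by simp
  show 1: "2 powi (3 * (int m - 1)) = (8 :: real) ^ (m - 1)"
    unfolding * power_int_of_nat by (simp add: power_mult)
  have "3 * (1 - int m) = - (3 * (int m - 1))" by simp
  then show "2 powi (3 * (1 - int m)) = 1 / (8 :: real) ^ (m - 1)"
    using 1 by (simp only: power_int_minus inverse_eq_divide)
qed

lemma inner_radius_eq: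
  assumes "m \<ge> 1"
  shows "inner_radius N m A = (MIN k\<in>{k\<in>{1..m}. A k \<noteq> 0}.
    root k (pell_weight m k / (subordinate_norm N (matrix_inv (A 0)) * subordinate_norm N (A k))))"
  unfolding inner_radius_def pell_weight_def powi_eq_power_8[OF assms] by simp

lemma outer_radius_eq:
  assumes "m \<ge> 1"
  shows "outer_radius N m A = (MAX k\<in>{1..m}.
    root k (subordinate_norm N (A (m - k)) * subordinate_norm N (matrix_inv (A m)) / pell_weight m k))"
  unfolding outer_radius_def pell_weight_def powi_eq_power_8[OF assms]
  by (simp add: field_simps)

section \<open>The two bounds on an eigenvalue\<close>

lemma inner_radius_le_cmod:
  assumes N: "vector_norm N" and m: "m \<ge> 1" and inv: "invertible (A 0)"
    and u: "u \<noteq> 0" and eigen: "matrix_poly m A z *v u = 0"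
  shows "inner_radius N m A \<le> cmod z"
proof (rule ccontr)
  let ?b = "subordinate_norm N (matrix_inv (A 0))"
  let ?a = "\<lambda>k. subordinate_norm N (A k)"
  assume "\<not> inner_radius N m A \<le> cmod z"
  then have z: "cmod z < inner_radius N m A" by simp
  have b: "?b > 0" using subordinate_norm_pos[OF N] matrix_inv_nonzero[OF inv] .
  have "?b * (cmod (z ^ k) * ?a k) < pell_weight m k" if k: "k \<in> {1..m}" for k
  proof (cases "A k = 0")
    case True
    \<comment> \<open>An index omitted from the minimum contributes 0, still below its positive
      weight.\<close>
    then show ?thesis using pell_weight_pos[OF k] by (simp add: subordinate_norm_zero[OF N])
  next
    case False
    let ?r = "pell_weight m k / (?b * ?a k)"
    have a: "?a k > 0" using subordinate_norm_pos[OF N False] .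
    have "inner_radius N m A \<le> root k ?r"
      unfolding inner_radius_eq[OF m] using False k by (intro Min_le) auto
    then have "cmod z ^ k < root k ?r ^ k"
      using z k by (intro power_strict_mono) auto
    also have "root k ?r ^ k = ?r"
      using k a b pell_weight_pos[OF k] by (intro real_root_pow_pos2) auto
    finally show ?thesis using a b by (simp add: norm_power field_simps)
  qed
  then have "(\<Sum>k = 1..m. ?b * (cmod (z ^ k) * ?a k)) < (\<Sum>k = 1..m. pell_weight m k)"
    using m by (intro sum_strict_mono) auto
  moreover have "{..m} = insert 0 {1..m}" by auto
  then have "A 0 *v u + (\<Sum>k = 1..m. z ^ k *s (A k *v u)) = 0"
    using eigen by (simp add: matrix_poly_mult_vec)
  from subordinate_norm_sum_ge_1[OF N inv u _ this]
  have "1 \<le> (\<Sum>k = 1..m. ?b * (cmod (z ^ k) * ?a k))" by simp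
  ultimately show False using sum_pell_weight[OF m] by linarith
qed

lemma cmod_le_outer_radius:
  assumes N: "vector_norm N" and m: "m \<ge> 1" and inv: "invertible (A m)"
    and u: "u \<noteq> 0" and eigen: "matrix_poly m A z *v u = 0"
  shows "cmod z \<le> outer_radius N m A"
proof (rule ccontr)
  let ?b = "subordinate_norm N (matrix_inv (A m))"
  let ?a = "\<lambda>k. subordinate_norm N (A (m - k))"
  assume "\<not> cmod z \<le> outer_radius N m A"
  then have z: "outer_radius N m A < cmod z" by simp
  have nonneg: "?a k * ?b / pell_weight m k \<ge> 0" if "k \<in> {1..m}" for k
    using pell_weight_pos[OF that] by (simp add: subordinate_norm_nonneg[OF N])
  have le: "root k (?a k * ?b / pell_weight m k) \<le> outer_radius N m A" if "k \<in> {1..m}" for k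
    unfolding outer_radius_eq[OF m] using that by (intro Max_ge) auto
  \<comment> \<open>Nonnegativity of the radius forces \<open>z\<close> to be nonzero, so powers of
    \<open>z\<close> can be divided out.\<close>
  have "0 \<le> outer_radius N m A"
    using le[of 1] nonneg[of 1] m by simp
  then have "z \<noteq> 0" using z by auto
  have "?b * (cmod (1 / z ^ k) * ?a k) < pell_weight m k" if k: "k \<in> {1..m}" for k
  proof -
    have "?a k * ?b / pell_weight m k = root k (?a k * ?b / pell_weight m k) ^ k"
      using k nonneg[OF k] by (simp add: real_root_pow_pos2)
    also have "\<dots> < cmod z ^ k"
      using z k le[OF k] nonneg[OF k] by (intro power_strict_mono) auto
    finally show ?thesis
      using pell_weight_pos[OF k] \<open>z \<noteq> 0\<close> by (simp add: norm_power norm_divide field_simps)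
  qed
  then have "(\<Sum>k = 1..m. ?b * (cmod (1 / z ^ k) * ?a k)) < (\<Sum>k = 1..m. pell_weight m k)"
    using m by (intro sum_strict_mono) auto
  \<comment> \<open>This is the eigenvalue equation divided by \<open>z ^ m\<close>, with the index
    reversed so that the leading coefficient stands at \<open>k = 0\<close>.\<close>
  moreover have "A m *v u + (\<Sum>k = 1..m. (1 / z ^ k) *s (A (m - k) *v u)) = 0"
  proof -
    have "(\<Sum>k\<le>m. z ^ k *s (A k *v u)) = (\<Sum>k\<le>m. z ^ (m - k) *s (A (m - k) *v u))"
      by (rule sum.reindex_bij_witness[of _ "\<lambda>k. m - k" "\<lambda>k. m - k"]) auto
    also have "\<dots> = z ^ m *s (A m *v u) + (\<Sum>k = 1..m. z ^ (m - k) *s (A (m - k) *v u))"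
    proof -
      have "{..m} = insert 0 {1..m}" by auto
      then show ?thesis by simp
    qed
    finally have "z ^ m *s (A m *v u) + (\<Sum>k = 1..m. z ^ (m - k) *s (A (m - k) *v u)) = 0"
      using eigen by (simp only: matrix_poly_mult_vec)
    moreover have "(\<Sum>k = 1..m. z ^ (m - k) *s (A (m - k) *v u))
        = z ^ m *s (\<Sum>k = 1..m. (1 / z ^ k) *s (A (m - k) *v u))"
      unfolding vec.scale_sum_right using \<open>z \<noteq> 0\<close>
      by (intro sum.cong) (auto simp: power_diff)
    ultimately have "z ^ m *s (A m *v u + (\<Sum>k = 1..m. (1 / z ^ k) *s (A (m - k) *v u))) = 0"
      by (simp only: vec.scale_right_distrib)
    then show ?thesis using \<open>z \<noteq> 0\<close> by (simp only: vec.scale_eq_0_iff) simp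
  qed
  from subordinate_norm_sum_ge_1[OF N inv u _ this]
  have "1 \<le> (\<Sum>k = 1..m. ?b * (cmod (1 / z ^ k) * ?a k))" by simp
  ultimately show False using sum_pell_weight[OF m] by linarith
qed

theorem theorem3:
  fixes N :: "complex ^ 'n \<Rightarrow> real"
    and A :: "nat \<Rightarrow> complex ^ 'n ^ 'n"
    and m :: nat
  assumes "vector_norm N"
    and "m \<ge> 1"
    and "A m \<noteq> 0"
    and "invertible (A 0)"
    and "invertible (A m)"
  shows "eigenvalues (matrix_poly m A)
           \<subseteq> {z. inner_radius N m A \<le> cmod z \<and> cmod z \<le> outer_radius N m A}"
  using inner_radius_le_cmod cmod_le_outer_radius assms
  unfolding eigenvalues_def by blast

end
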